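(* Let $\mathbf{Q}\in\mathbb{R}^{N\times N}$ be symmetric positive definite, $\mathbf{c}\in\mathbb{R}^N$, $\gamma>0$, with $c_n^2/(\mathbf{Q}^{-1})_{nn}\le\gamma$ for all $n=1,\ldots,N$. Assume that $\mathbf{Q}$ is diagonally dominant in the sense that $$\max_m\sum_{n\neq m}\frac{|Q_{mn}|}{\sqrt{Q_{mm}Q_{nn}}}<1.$$ Let $K^*$ and $K_d$ be the maximum numbers of zero-valued components in the cardinality minimization problem with data $(\mathbf{Q},\mathbf{c},\gamma)$ and in its diagonal relaxation, respectively (see context). Let $Z_{\mathrm{dd}}(K)$ be the index set corresponding to the $K$ smallest values of $Q_{nn}c_n^2$, and define $$\underline{K}_{\mathrm{dd}}=\max\left\{K:\left(1+\max_{m\in Z_{\mathrm{dd}}(K)}\sum_{n\in Z_{\mathrm{dd}}(K),\, n\neq m}\frac{|Q_{mn}|}{\sqrt{Q_{mm}Q_{nn}}}\right)S_K(\{Q_{nn}c_n^2\})\le\gamma\right\},$$ $$\overline{K}_{\mathrm{dd}}=\max\left\{K:\left(1-\max_m\sum_{n\neq m}\frac{|Q_{mn}|}{\sqrt{Q_{mm}Q_{nn}}}\right)S_K(\{Q_{nn}c_n^2\})\le\gamma\right\}.$$ Then $\underline{K}_{\mathrm{dd}}\le K^*\le K_d\le\overline{K}_{\mathrm{dd}}$. The approximation ratio $K_d/K^*$ is bounded as follows: $$\frac{K_d}{K^*}\le\frac{\overline{K}_{\mathrm{dd}}}{\underline{K}_{\mathrm{dd}}}\le\frac{\lceil(\underline{K}_{\mathrm{dd}}+1)\,r_{\mathrm{dd}}\rceil-1}{\underline{K}_{\mathrm{dd}}},$$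 where $$r_{\mathrm{dd}}=\left(1+\max_{m\in Z_{\mathrm{dd}}(\underline{K}_{\mathrm{dd}}+1)}\sum_{n\in Z_{\mathrm{dd}}(\underline{K}_{\mathrm{dd}}+1),\, n\neq m}\frac{|Q_{mn}|}{\sqrt{Q_{mm}Q_{nn}}}\right)\Bigg/\left(1-\max_m\sum_{n\neq m}\frac{|Q_{mn}|}{\sqrt{Q_{mm}Q_{nn}}}\right).$$
   Context: The cardinality minimization problem with data $(\mathbf{Q},\mathbf{c},\gamma)$ is: minimize $C(\mathbf{x})$, the number of nonzero components of $\mathbf{x}\in\mathbb{R}^N$, subject to $(\mathbf{x}-\mathbf{c})^T\mathbf{Q}(\mathbf{x}-\mathbf{c})\le\gamma$. $K^*$ is $N$ minus its optimal cost, i.e. the maximum number of zero components of a feasible $\mathbf{x}$. The assumption on $c_n^2/(\mathbf{Q}^{-1})_{nn}$ says that for each $n$ there is a feasible $\mathbf{x}$ with $x_n=0$. $S_K(\{a_n\})$ denotes the sum of the $K$ smallest elements of the sequence $a_1,\ldots,a_N$; $K$ always denotes a number of components, at most $N$. Diagonal relaxation: for a diagonal matrix $\mathbf{D}$ with $\mathbf{0}\preceq\mathbf{D}\preceq\mathbf{Q}$ (Loewner order), replacing $\mathbf{Q}$ by $\mathbf{D}$ in the constraint gives a relaxation of the problem, which admits a feasible point with $K$ zero components iff $S_K(\{D_{nn}c_n^2\})\le\gamma$. The diagonal relaxation is the tightest relaxation of this kind. With $$E_d(K)=\max\{S_K(\{D_{nn}c_n^2\}):\mathbf{D}\text{ diagonal},\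 \mathbf{0}\preceq\mathbf{D}\preceq\mathbf{Q}\},$$ $K_d$ is the largest $K$ such that $E_d(K)\le\gamma$. *)

theory Defs
  imports "HOL-Analysis.Analysis"
begin

text \<open>Symmetric real matrices with the Loewner order. The dimension \<open>N\<close> is \<open>CARD('n)\<close>.\<close>

definition pos_def :: "real^'n^'n \<Rightarrow> bool" where
  "pos_def A \<longleftrightarrow> transpose A = A \<and> (\<forall>x. x \<noteq> 0 \<longrightarrow> x \<bullet> (A *v x) > 0)"

definition pos_semidef :: "real^'n^'n \<Rightarrow> bool" where
  "pos_semidef A \<longleftrightarrow> transpose A = A \<and> (\<forall>x. x \<bullet> (A *v x) \<ge> 0)"

definition loewner_le :: "real^'n^'n \<Rightarrow> real^'n^'n \<Rightarrow> bool" where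
  "loewner_le A B \<longleftrightarrow> pos_semidef (B - A)"

definition is_diagonal :: "real^'n^'n \<Rightarrow> bool" where
  "is_diagonal A \<longleftrightarrow> (\<forall>i j. i \<noteq> j \<longrightarrow> A $ i $ j = 0)"


definition feasible_set :: "real^'n^'n \<Rightarrow> real^'n \<Rightarrow> real \<Rightarrow> (real^'n) set" where
  "feasible_set Q c \<gamma> = {x. (x - c) \<bullet> (Q *v (x - c)) \<le> \<gamma>}"

definition num_nonzero :: "real^'n \<Rightarrow> nat" where
  "num_nonzero x = card {n. x $ n \<noteq> 0}"

definition opt_cost :: "real^'n^'n \<Rightarrow> real^'n \<Rightarrow> real \<Rightarrow> nat" where
  "opt_cost Q c \<gamma> = Min (num_nonzero ` feasible_set Q c \<gamma>)"

definition K_star :: "real^'n^'n \<Rightarrow> real^'n \<Rightarrow> real \<Rightarrow> nat" where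
  "K_star Q c \<gamma> = CARD('n) - opt_cost Q c \<gamma>"

lemma K_star_eq_Max_zeros:
  fixes Q :: "real^'n^'n"
  assumes "\<gamma> \<ge> 0"
  shows "K_star Q c \<gamma> = Max ((\<lambda>x. card {n. x $ n = 0}) ` feasible_set Q c \<gamma>)"
proof -
  let ?F = "feasible_set Q c \<gamma>"
  have split: "card {n. x $ n = 0} + num_nonzero x = CARD('n)" for x :: "real^'n"
  proof -
    have "card ({n. x $ n = 0} \<union> {n. x $ n \<noteq> 0}) = card {n. x $ n = 0} + card {n. x $ n \<noteq> 0}"
      by (rule card_Un_disjoint) auto
    moreover have "{n. x $ n = 0} \<union> {n. x $ n \<noteq> 0} = UNIV" by auto
    ultimately show ?thesis by (simp add: num_nonzero_def)
  qed
  have "num_nonzero ` ?F \<subseteq> {..CARD('n)}"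
    using split by (metis atMost_iff image_subsetI le_add2)
  then have fin: "finite (num_nonzero ` ?F)"
    by (rule finite_subset) simp
  have "c \<in> ?F" using assms by (simp add: feasible_set_def)
  then have "opt_cost Q c \<gamma> \<in> num_nonzero ` ?F"
    unfolding opt_cost_def using fin by (intro Min_in) auto
  then obtain x where x: "x \<in> ?F" "opt_cost Q c \<gamma> = num_nonzero x" by auto
  have le: "num_nonzero x \<le> num_nonzero y" if "y \<in> ?F" for y
    using that fin x(2) unfolding opt_cost_def by (metis Min_le imageI)
  have eq: "K_star Q c \<gamma> = card {n. x $ n = 0}"
    using split[of x] x(2) by (simp add: K_star_def)
  have "card {n. y $ n = 0} \<le> card {n. x $ n = 0}" if "y \<in> ?F" for y
    using le[OF that] split[of x] split[of y] by linarith
  moreover have "finite ((\<lambda>x. card {n. x $ n = 0}) ` ?F)"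
    by (rule finite_subset[of _ "{..CARD('n)}"]) (auto intro: card_mono)
  ultimately show ?thesis
    unfolding eq using x(1) by (intro Max_eqI[symmetric]) auto
qed


text \<open>\<open>S\<^sub>K({a\<^sub>n})\<close>, the sum of the \<open>K\<close> smallest elements, counted with multiplicity.\<close>

definition smallest_sum :: "nat \<Rightarrow> ('n::finite \<Rightarrow> real) \<Rightarrow> real" where
  "smallest_sum K a = sum_list (take K (sorted_list_of_multiset (image_mset a (mset_set UNIV))))"

text \<open>The maximum over \<open>D\<close> is written as a supremum. The set contains \<open>0\<close> (take \<open>D = 0\<close>), is
  bounded above since \<open>D\<^sub>n\<^sub>n \<le> Q\<^sub>n\<^sub>n\<close>, and the supremum is attained because the set of admissible
  \<open>D\<close> is compact and \<open>S\<^sub>K\<close> is continuous.\<close>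

definition E_diag :: "real^'n^'n \<Rightarrow> real^'n \<Rightarrow> nat \<Rightarrow> real" where
  "E_diag Q c K = Sup {smallest_sum K (\<lambda>n. D $ n $ n * (c $ n)\<^sup>2) | D.
     is_diagonal D \<and> loewner_le 0 D \<and> loewner_le D Q}"

definition K_diag :: "real^'n^'n \<Rightarrow> real^'n \<Rightarrow> real \<Rightarrow> nat" where
  "K_diag Q c \<gamma> = Max {K. K \<le> CARD('n) \<and> E_diag Q c K \<le> \<gamma>}"


text \<open>The largest off-diagonal row sum of the normalised matrix, restricted to the index set \<open>Z\<close>.
  It is unspecified for \<open>Z = {}\<close>; in \<open>K_dd_lower\<close> this concerns only \<open>K = 0\<close>, where
  it is multiplied by \<open>S\<^sub>0 = 0\<close>.\<close>

definition dd_max :: "real^'n^'n \<Rightarrow> 'n set \<Rightarrow> real" where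
  "dd_max Q Z = Max ((\<lambda>m. \<Sum>n\<in>Z - {m}. \<bar>Q $ m $ n\<bar> / sqrt (Q $ m $ m * Q $ n $ n)) ` Z)"

text \<open>An index set of the \<open>K\<close> smallest values. It need not be unique when there are ties. For
  \<open>K \<ge> N\<close> it is the set of all indices; the case \<open>K = N + 1\<close> enters \<open>r_dd\<close> if
  \<open>K_dd_lower = N\<close>.\<close>

definition smallest_index_set :: "('n::finite \<Rightarrow> real) \<Rightarrow> nat \<Rightarrow> 'n set \<Rightarrow> bool" where
  "smallest_index_set a K Z \<longleftrightarrow>
     card Z = min K CARD('n) \<and> (\<forall>i\<in>Z. \<forall>j. j \<notin> Z \<longrightarrow> a i \<le> a j)"

definition K_dd_lower :: "real^'n^'n \<Rightarrow> real^'n \<Rightarrow> real \<Rightarrow> (nat \<Rightarrow> 'n set) \<Rightarrow> nat" where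
  "K_dd_lower Q c \<gamma> Z = Max {K. K \<le> CARD('n) \<and>
     (1 + dd_max Q (Z K)) * smallest_sum K (\<lambda>n. Q $ n $ n * (c $ n)\<^sup>2) \<le> \<gamma>}"

definition K_dd_upper :: "real^'n^'n \<Rightarrow> real^'n \<Rightarrow> real \<Rightarrow> nat" where
  "K_dd_upper Q c \<gamma> = Max {K. K \<le> CARD('n) \<and>
     (1 - dd_max Q UNIV) * smallest_sum K (\<lambda>n. Q $ n $ n * (c $ n)\<^sup>2) \<le> \<gamma>}"

definition r_dd :: "real^'n^'n \<Rightarrow> real^'n \<Rightarrow> real \<Rightarrow> (nat \<Rightarrow> 'n set) \<Rightarrow> real" where
  "r_dd Q c \<gamma> Z = (1 + dd_max Q (Z (K_dd_lower Q c \<gamma> Z + 1))) / (1 - dd_max Q UNIV)"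

text \<open>A quotient of two nonnegative numbers in the extended reals, so that \<open>a / 0 = \<infinity>\<close> for
  \<open>a > 0\<close>. This is needed because \<open>K_dd_lower\<close> can be \<open>0\<close>.\<close>

definition ratio :: "real \<Rightarrow> real \<Rightarrow> ereal" where
  "ratio a b = ereal a / ereal b"

end

theory Submission
  imports Defs
begin

text \<open>
  Rescale by \<open>u\<^sub>n = sqrt Q\<^sub>n\<^sub>n * y\<^sub>n\<close>: the quadratic form of \<open>Q\<close> becomes that of a matrix with unit
  diagonal whose off-diagonal absolute row sums are the quantities in \<open>dd_max\<close>. By
  \<open>2 * \<bar>u * v\<bar> \<le> u\<^sup>2 + v\<^sup>2\<close>, the form at a vector supported on \<open>A\<close> then differs from its diagonal
  part \<open>\<Sum>n\<in>A. Q\<^sub>n\<^sub>n * y\<^sub>n\<^sup>2\<close> by at most the fraction \<open>dd_max Q A\<close> of that part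
  (\<open>quadratic_form_diagonal_estimate\<close>). Both outer bounds on the number of zeros follow from
  this one estimate.

  For the lower bound, the point that is zero on \<open>Z K\<close> and agrees with \<open>c\<close> elsewhere gives the
  constraint a value of at most \<open>(1 + dd_max Q (Z K)) * S\<^sub>K\<close>; this is at most \<open>\<gamma>\<close> for
  \<open>K = K_dd_lower\<close>, so \<open>K_star\<close> is no smaller. For the upper bound, the estimate on the
  whole index set says that \<open>(1 - dd_max Q UNIV) * diag Q\<close> lies below \<open>Q\<close> in the Loewner order, so
  it competes in the diagonal relaxation and yields the value \<open>(1 - dd_max Q UNIV) * S\<^sub>K\<close>. The
  middle inequality holds since every diagonal \<open>D\<close> below \<open>Q\<close> enlarges the feasible set: for a
  feasible \<open>x\<close>, the values \<open>D\<^sub>n\<^sub>n * c\<^sub>n\<^sup>2\<close> at the zeros of \<open>x\<close> have a sum of at most \<open>\<gamma>\<close>, whatever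
  \<open>D\<close> is.

  For the ratio, write \<open>l = K_dd_lower + 1\<close> and \<open>u = K_dd_upper\<close>. If \<open>u < l\<close>, then \<open>u < l * r_dd\<close>
  because \<open>r_dd \<ge> 1\<close>. If \<open>l \<le> u\<close>, maximality of \<open>K_dd_lower\<close> gives
  \<open>(1 - dd_max Q UNIV) * S\<^sub>u \<le> \<gamma> < (1 + dd_max Q (Z l)) * S\<^sub>l\<close>, that is \<open>S\<^sub>u / S\<^sub>l < r_dd\<close>. The mean
  of the \<open>K\<close> smallest values grows with \<open>K\<close> (\<open>smallest_sum_average_mono\<close>), so
  \<open>u / l \<le> S\<^sub>u / S\<^sub>l\<close>, hence again \<open>u < l * r_dd\<close>. Since \<open>u\<close> is an integer, this is
  \<open>u \<le> \<lceil>l * r_dd\<rceil> - 1\<close>.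
\<close>

section \<open>Sums of the smallest values\<close>

text \<open>The sorted list of all values is the sorted list of the values on \<open>Z\<close> followed by that of
  the values off \<open>Z\<close>: their concatenation is already sorted, and sorted lists with the same
  multiset agree. Ties between indices thus do not affect the sum.\<close>

lemma smallest_sum_eq_sum:
  fixes a :: "'n::finite \<Rightarrow> real"
  assumes "smallest_index_set a K Z"
  shows "smallest_sum K a = sum a Z"
proof -
  define L where "L = (\<lambda>A. sorted_list_of_multiset (image_mset a (mset_set A)))"
  have mset_L: "mset (L A) = image_mset a (mset_set A)" and sorted_L: "sorted (L A)" for A
    by (simp_all add: L_def)
  have set_L: "set (L A) = a ` A" for A
    using mset_L[of A] by (metis finite finite_set_mset_mset_set set_image_mset set_mset_mset)
  have card_Z: "card Z = min K CARD('n)" and le: "\<And>i j. i \<in> Z \<Longrightarrow> j \<notin> Z \<Longrightarrow> a i \<le> a j"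
    using assms by (auto simp: smallest_index_set_def)
  have "mset_set UNIV = mset_set Z + mset_set (- Z)"
    by (metis Compl_partition Compl_disjoint finite mset_set_Union)
  then have "mset (L Z @ L (- Z)) = image_mset a (mset_set UNIV)"
    by (simp add: mset_L)
  moreover have "sorted (L Z @ L (- Z))"
    using le by (auto simp: sorted_append sorted_L set_L)
  ultimately have split: "L UNIV = L Z @ L (- Z)"
    by (metis L_def sorted_list_of_multiset_mset sorted_sort_id)
  have len: "length (L A) = card A" for A
    by (metis mset_L size_image_mset size_mset size_mset_set)
  have "take K (L UNIV) = L Z"
  proof (cases "K \<le> CARD('n)")
    case True
    then show ?thesis using split len card_Z by simp
  next
    case False
    then have "card Z = CARD('n)" using card_Z by simp
    then have "Z = UNIV" by (simp add: card_eq_UNIV_imp_eq_UNIV)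
    then show ?thesis using len False by simp
  qed
  moreover have "sum_list (L Z) = sum a Z"
    by (metis mset_L sum_mset_sum_list sum_unfold_sum_mset)
  ultimately show ?thesis by (simp add: smallest_sum_def L_def)
qed

lemma smallest_index_set_exists: "\<exists>Z. smallest_index_set (a :: 'n::finite \<Rightarrow> real) K Z"
proof -
  obtain xs where xs: "set xs = (UNIV :: 'n set)" "distinct xs"
    using finite_distinct_list[OF finite] by blast
  define ys where "ys = sort_key a xs"
  have ys: "set ys = UNIV" "distinct ys" "sorted (map a ys)"
    using xs by (auto simp: ys_def)
  have "card (set (take K ys)) = min K CARD('n)"
    using ys by (metis distinct_card distinct_take length_take min.commute)
  moreover have "a i \<le> a j" if "i \<in> set (take K ys)" "j \<notin> set (take K ys)" for i j
  proof -
    have "sorted (map a (take K ys) @ map a (drop K ys))"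
      using ys(3) by (metis append_take_drop_id map_append)
    moreover have "j \<in> set (drop K ys)"
      using that ys(1) by (metis UNIV_I Un_iff append_take_drop_id set_append)
    ultimately show ?thesis using that(1) by (auto simp: sorted_append)
  qed
  ultimately show ?thesis unfolding smallest_index_set_def by blast
qed

text \<open>A set of smallest values is exchanged for \<open>A\<close> one element at a time, along a bijection
  between \<open>Z - A\<close> and \<open>A - Z\<close>; no exchange decreases the sum.\<close>

lemma smallest_sum_le_sum:
  fixes a :: "'n::finite \<Rightarrow> real"
  shows "smallest_sum (card A) a \<le> sum a A"
proof -
  obtain Z where Z: "smallest_index_set a (card A) Z"
    using smallest_index_set_exists by blast
  have "card Z = card A"
    using Z by (simp add: smallest_index_set_def card_mono min_absorb1)
  then have "card (Z - A) = card (A - Z)"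
    by (simp add: card_Diff_subset_Int Int_commute)
  then obtain f where f: "bij_betw f (Z - A) (A - Z)"
    using finite_same_card_bij[of "Z - A" "A - Z"] by auto
  have "a i \<le> a (f i)" if "i \<in> Z - A" for i
    using Z that bij_betwE[OF f] by (auto simp: smallest_index_set_def)
  then have "sum a (Z - A) \<le> (\<Sum>i\<in>Z - A. a (f i))"
    by (rule sum_mono)
  also have "\<dots> = sum a (A - Z)"
    by (rule sum.reindex_bij_betw[OF f])
  finally have "sum a (Z - A) + sum a (Z \<inter> A) \<le> sum a (A - Z) + sum a (A \<inter> Z)"
    by (simp add: Int_commute)
  then have "sum a Z \<le> sum a A"
    by (metis add.commute finite sum.Int_Diff)
  then show ?thesis using smallest_sum_eq_sum[OF Z] by simp
qed

lemma smallest_sum_scale: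
  fixes a :: "'n::finite \<Rightarrow> real"
  assumes "t \<ge> 0"
  shows "smallest_sum K (\<lambda>n. t * a n) = t * smallest_sum K a"
proof -
  obtain Z where Z: "smallest_index_set a K Z"
    using smallest_index_set_exists by blast
  then have "smallest_index_set (\<lambda>n. t * a n) K Z"
    using assms by (auto simp: smallest_index_set_def intro: mult_left_mono)
  then show ?thesis
    using smallest_sum_eq_sum Z by (metis (no_types, lifting) sum.cong sum_distrib_left)
qed

lemma smallest_sum_zero [simp]: "smallest_sum 0 a = 0"
  by (simp add: smallest_sum_def)

text \<open>The mean of the \<open>K\<close> smallest values does not exceed the mean of the \<open>L\<close> smallest ones;
  multiplied out, so that \<open>K = 0\<close> is covered. Each of the \<open>L - K\<close> additional values is at least
  each of the first \<open>K\<close>, and summing over all such pairs gives the claim.\<close>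

lemma smallest_sum_average_mono:
  fixes a :: "'n::finite \<Rightarrow> real"
  assumes "K \<le> L" "L \<le> CARD('n)"
  shows "real L * smallest_sum K a \<le> real K * smallest_sum L a"
proof -
  define xs where "xs = sorted_list_of_multiset (image_mset a (mset_set UNIV))"
  have sorted: "sorted xs" by (simp add: xs_def)
  have len: "length xs = CARD('n)"
    by (metis mset_sorted_list_of_multiset size_image_mset size_mset size_mset_set xs_def)
  have S: "smallest_sum k a = (\<Sum>i<k. xs ! i)" if "k \<le> CARD('n)" for k
    using that len
    by (simp add: smallest_sum_def xs_def[symmetric] sum_list_sum_nth atLeast0LessThan)
  have "real K * (\<Sum>i\<in>{K..<L}. xs ! i) = (\<Sum>i\<in>{K..<L}. \<Sum>j<K. xs ! i)"
    by (simp add: sum_distrib_left)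
  also have "\<dots> \<ge> (\<Sum>i\<in>{K..<L}. \<Sum>j<K. xs ! j)"
    using sorted assms len by (intro sum_mono) (auto intro!: sorted_nth_mono)
  finally have "real (L - K) * (\<Sum>j<K. xs ! j) \<le> real K * (\<Sum>i\<in>{K..<L}. xs ! i)"
    by simp
  moreover have "(\<Sum>i<L. xs ! i) = (\<Sum>i<K. xs ! i) + (\<Sum>i\<in>{K..<L}. xs ! i)"
    using assms(1) by (simp add: lessThan_atLeast0 sum.atLeastLessThan_concat)
  ultimately show ?thesis
    using S[of K] S[of L] assms by (simp add: of_nat_diff algebra_simps)
qed

section \<open>Diagonal dominance and the quadratic form\<close>

lemma pos_def_diagonal_pos:
  fixes Q :: "real^'n^'n"
  assumes "pos_def Q" shows "Q $ n $ n > 0"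
proof -
  have "axis n 1 \<noteq> (0 :: real^'n)"
    by (simp add: axis_eq_0_iff)
  then have "axis n 1 \<bullet> (Q *v axis n 1) > 0"
    using assms by (simp add: pos_def_def)
  then show ?thesis
    by (simp add: inner_axis' matrix_vector_mul_component inner_axis)
qed

lemma quadratic_form_eq_sum:
  fixes A :: "real^'n^'n"
  shows "y \<bullet> (A *v y) = (\<Sum>m\<in>UNIV. \<Sum>n\<in>UNIV. y $ m * A $ m $ n * y $ n)"
  by (simp add: inner_vec_def matrix_vector_mult_def sum_distrib_left mult.assoc)

lemma diagonal_quadratic_form:
  fixes D :: "real^'n^'n"
  assumes "is_diagonal D"
  shows "y \<bullet> (D *v y) = (\<Sum>n\<in>UNIV. D $ n $ n * (y $ n)\<^sup>2)"
proof -
  have "(\<Sum>n\<in>UNIV. y $ m * D $ m $ n * y $ n) = D $ m $ m * (y $ m)\<^sup>2" for m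
  proof -
    have "(\<Sum>n\<in>UNIV. y $ m * D $ m $ n * y $ n) = (\<Sum>n\<in>{m}. y $ m * D $ m $ n * y $ n)"
      using assms by (intro sum.mono_neutral_right) (auto simp: is_diagonal_def)
    then show ?thesis by (simp add: power2_eq_square)
  qed
  then show ?thesis by (simp add: quadratic_form_eq_sum)
qed

lemma dd_max_nonneg:
  fixes Q :: "real^'n^'n"
  assumes "pos_def Q" "A \<noteq> {}"
  shows "dd_max Q A \<ge> 0"
proof -
  obtain m where "m \<in> A" using assms(2) by blast
  then have "(\<Sum>n\<in>A - {m}. \<bar>Q $ m $ n\<bar> / sqrt (Q $ m $ m * Q $ n $ n)) \<le> dd_max Q A"
    unfolding dd_max_def by (intro Max_ge) auto
  moreover have "(\<Sum>n\<in>A - {m}. \<bar>Q $ m $ n\<bar> / sqrt (Q $ m $ m * Q $ n $ n)) \<ge> 0"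
    using pos_def_diagonal_pos[OF assms(1)]
    by (intro sum_nonneg divide_nonneg_nonneg) (auto simp: less_imp_le)
  ultimately show ?thesis by linarith
qed

text \<open>A Gershgorin-type bound in both directions. With \<open>w\<^sub>n = Q\<^sub>n\<^sub>n * y\<^sub>n\<^sup>2\<close>, the entry at \<open>m \<noteq> n\<close>
  contributes at most \<open>r\<^sub>m\<^sub>n * (w\<^sub>m + w\<^sub>n) / 2\<close>, where \<open>r\<^sub>m\<^sub>n\<close> is the normalised off-diagonal entry.
  As \<open>r\<close> is symmetric, the two halves have the same total, which is the sum of the \<open>w\<^sub>m\<close> weighted
  by the row sums of \<open>r\<close>.\<close>

lemma quadratic_form_diagonal_estimate:
  fixes Q :: "real^'n^'n"
  assumes Q: "pos_def Q" and supp: "\<And>n. n \<notin> A \<Longrightarrow> y $ n = 0"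
  shows "\<bar>y \<bullet> (Q *v y) - (\<Sum>n\<in>A. Q $ n $ n * (y $ n)\<^sup>2)\<bar>
           \<le> dd_max Q A * (\<Sum>n\<in>A. Q $ n $ n * (y $ n)\<^sup>2)"
proof -
  define R where "R = (\<lambda>m n. \<bar>Q $ m $ n\<bar> / sqrt (Q $ m $ m * Q $ n $ n))"
  define r where "r = (\<lambda>m n. if m = n then 0 else R m n)"
  define w where "w = (\<lambda>n. Q $ n $ n * (y $ n)\<^sup>2)"
  have pos: "Q $ n $ n > 0" for n using pos_def_diagonal_pos[OF Q] .
  have sym: "Q $ m $ n = Q $ n $ m" for m n
  proof -
    have "Q $ m $ n = transpose Q $ n $ m" by (simp add: transpose_def)
    then show ?thesis using Q by (simp add: pos_def_def)
  qed
  have R_nonneg: "R m n \<ge> 0" for m n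
    using pos[of m] pos[of n] by (simp add: R_def)
  have r_sym: "r m n = r n m" for m n
    by (auto simp: r_def R_def sym mult.commute)
  have w_nonneg: "w n \<ge> 0" for n using pos[of n] by (simp add: w_def)
  have entry: "\<bar>(if m = n then 0 else y $ m * Q $ m $ n * y $ n)\<bar> \<le> r m n * (w m + w n) / 2" for m n
  proof (cases "m = n")
    case False
    define u where "u = sqrt (Q $ m $ m) * \<bar>y $ m\<bar>"
    define v where "v = sqrt (Q $ n $ n) * \<bar>y $ n\<bar>"
    have "\<bar>y $ m * Q $ m $ n * y $ n\<bar> = R m n * (u * v)"
      using pos[of m] pos[of n]
      by (simp add: R_def u_def v_def abs_mult real_sqrt_mult)
    also have "\<dots> \<le> R m n * ((u\<^sup>2 + v\<^sup>2) / 2)"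
      using R_nonneg sum_squares_bound[of u v] by (intro mult_left_mono) auto
    also have "u\<^sup>2 = w m" using pos[of m] by (simp add: u_def w_def power_mult_distrib)
    also have "v\<^sup>2 = w n" using pos[of n] by (simp add: v_def w_def power_mult_distrib)
    finally show ?thesis using False by (simp add: r_def)
  qed (simp add: r_def)
  have "y \<bullet> (Q *v y) = (\<Sum>m\<in>A. \<Sum>n\<in>UNIV. y $ m * Q $ m $ n * y $ n)"
    unfolding quadratic_form_eq_sum by (intro sum.mono_neutral_right) (auto simp: supp)
  also have "\<dots> = (\<Sum>m\<in>A. \<Sum>n\<in>A. y $ m * Q $ m $ n * y $ n)"
    by (intro sum.cong refl sum.mono_neutral_right) (auto simp: supp)
  also have "\<dots> = (\<Sum>m\<in>A. w m + (\<Sum>n\<in>A. if m = n then 0 else y $ m * Q $ m $ n * y $ n))"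
  proof (intro sum.cong refl)
    fix m assume m: "m \<in> A"
    have "(\<Sum>n\<in>A. y $ m * Q $ m $ n * y $ n) =
      (\<Sum>n\<in>A. (if m = n then w m else 0) + (if m = n then 0 else y $ m * Q $ m $ n * y $ n))"
      by (intro sum.cong refl) (auto simp: w_def power2_eq_square)
    then show "(\<Sum>n\<in>A. y $ m * Q $ m $ n * y $ n) =
      w m + (\<Sum>n\<in>A. if m = n then 0 else y $ m * Q $ m $ n * y $ n)"
      using m by (simp add: sum.distrib)
  qed
  finally have "\<bar>y \<bullet> (Q *v y) - sum w A\<bar>
      = \<bar>\<Sum>m\<in>A. \<Sum>n\<in>A. if m = n then 0 else y $ m * Q $ m $ n * y $ n\<bar>"
    by (simp add: sum.distrib)
  also have "\<dots> \<le> (\<Sum>m\<in>A. \<Sum>n\<in>A. r m n * (w m + w n) / 2)"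
    by (intro order_trans[OF sum_abs] sum_mono order_trans[OF sum_abs] entry)
  also have "\<dots> = ((\<Sum>m\<in>A. \<Sum>n\<in>A. r m n * w m) + (\<Sum>m\<in>A. \<Sum>n\<in>A. r m n * w n)) / 2"
    by (simp add: distrib_left sum.distrib sum_divide_distrib add_divide_distrib)
  also have "(\<Sum>m\<in>A. \<Sum>n\<in>A. r m n * w n) = (\<Sum>m\<in>A. \<Sum>n\<in>A. r m n * w m)"
    by (subst sum.swap) (simp add: r_sym)
  also have "((\<Sum>m\<in>A. \<Sum>n\<in>A. r m n * w m) + (\<Sum>m\<in>A. \<Sum>n\<in>A. r m n * w m)) / 2
      = (\<Sum>m\<in>A. (\<Sum>n\<in>A. r m n) * w m)"
    by (simp add: sum_distrib_right)
  also have "\<dots> \<le> (\<Sum>m\<in>A. dd_max Q A * w m)"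
  proof (intro sum_mono mult_right_mono w_nonneg)
    fix m assume m: "m \<in> A"
    have "(\<Sum>n\<in>A. r m n) = (\<Sum>n\<in>A - {m}. R m n)"
      by (intro sum.mono_neutral_cong_right) (auto simp: r_def)
    also have "\<dots> \<le> dd_max Q A"
      using m unfolding dd_max_def R_def by (intro Max_ge) auto
    finally show "(\<Sum>n\<in>A. r m n) \<le> dd_max Q A" .
  qed
  finally show ?thesis by (simp add: w_def sum_distrib_left)
qed

section \<open>Diagonal matrices below \<open>Q\<close>\<close>

definition dd_diagonal :: "real^'n^'n \<Rightarrow> real^'n^'n" where
  "dd_diagonal Q = (\<chi> i j. if i = j then (1 - dd_max Q UNIV) * Q $ i $ i else 0)"

lemma loewner_leD: "loewner_le A B \<Longrightarrow> x \<bullet> (A *v x) \<le> x \<bullet> (B *v x)"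
  by (auto simp: loewner_le_def pos_semidef_def matrix_vector_mult_diff_rdistrib inner_diff_right
      dest: spec[of _ x])

lemma loewner_leI:
  assumes "transpose A = A" "transpose B = B" "\<And>x. x \<bullet> (A *v x) \<le> x \<bullet> (B *v x)"
  shows "loewner_le A B"
proof -
  have "transpose (B - A) = B - A"
    using assms(1,2) by (simp add: vec_eq_iff transpose_def)
  then show ?thesis
    using assms(3)
    by (simp add: loewner_le_def pos_semidef_def matrix_vector_mult_diff_rdistrib inner_diff_right)
qed

lemma diagonal_transpose:
  assumes "is_diagonal D" shows "transpose D = D"
proof -
  have "D $ j $ i = D $ i $ j" for i j
    using assms by (cases "i = j") (auto simp: is_diagonal_def)
  then show ?thesis by (simp add: vec_eq_iff transpose_def)
qed

lemma diagonal_below_entry_nonneg: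
  assumes "loewner_le 0 D"
  shows "D $ n $ n \<ge> 0"
  using loewner_leD[OF assms, of "axis n 1"]
  by (simp add: inner_axis' matrix_vector_mul_component inner_axis)

lemma dd_diagonal_admissible:
  assumes "pos_def Q" "dd_max Q UNIV < 1"
  shows "is_diagonal (dd_diagonal Q)" "loewner_le 0 (dd_diagonal Q)" "loewner_le (dd_diagonal Q) Q"
proof -
  show diag: "is_diagonal (dd_diagonal Q)"
    by (simp add: is_diagonal_def dd_diagonal_def)
  have form: "x \<bullet> (dd_diagonal Q *v x) = (1 - dd_max Q UNIV) * (\<Sum>n\<in>UNIV. Q $ n $ n * (x $ n)\<^sup>2)" for x
    unfolding diagonal_quadratic_form[OF diag]
    by (simp add: dd_diagonal_def sum_distrib_left mult.assoc)
  have "(\<Sum>n\<in>UNIV. Q $ n $ n * (x $ n)\<^sup>2) \<ge> 0" for x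
    using pos_def_diagonal_pos[OF assms(1)] by (intro sum_nonneg) (auto simp: less_imp_le)
  then show "loewner_le 0 (dd_diagonal Q)"
    using assms(2)
    by (intro loewner_leI diagonal_transpose[OF diag]) (auto simp: form transpose_def vec_eq_iff)
  have "x \<bullet> (dd_diagonal Q *v x) \<le> x \<bullet> (Q *v x)" for x
    using quadratic_form_diagonal_estimate[OF assms(1), of UNIV x]
    by (simp add: form algebra_simps abs_le_iff)
  then show "loewner_le (dd_diagonal Q) Q"
    using assms(1) by (intro loewner_leI diagonal_transpose[OF diag]) (auto simp: pos_def_def)
qed

text \<open>At an index where \<open>x\<close> vanishes, \<open>(x - c)\<^sub>n\<^sup>2 = c\<^sub>n\<^sup>2\<close>; the other terms of the diagonal form are
  nonnegative and can be dropped.\<close>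

lemma feasible_diagonal_bound:
  assumes "x \<in> feasible_set Q c \<gamma>" "A \<subseteq> {n. x $ n = 0}"
    and "is_diagonal D" "loewner_le 0 D" "loewner_le D Q"
  shows "smallest_sum (card A) (\<lambda>n. D $ n $ n * (c $ n)\<^sup>2) \<le> \<gamma>"
proof -
  have "smallest_sum (card A) (\<lambda>n. D $ n $ n * (c $ n)\<^sup>2) \<le> (\<Sum>n\<in>A. D $ n $ n * (c $ n)\<^sup>2)"
    by (rule smallest_sum_le_sum)
  also have "\<dots> = (\<Sum>n\<in>A. D $ n $ n * ((x - c) $ n)\<^sup>2)"
    using assms(2) by (intro sum.cong) auto
  also have "\<dots> \<le> (\<Sum>n\<in>UNIV. D $ n $ n * ((x - c) $ n)\<^sup>2)"
    using diagonal_below_entry_nonneg[OF assms(4)] by (intro sum_mono2) auto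
  also have "\<dots> = (x - c) \<bullet> (D *v (x - c))"
    by (rule diagonal_quadratic_form[OF assms(3), symmetric])
  also have "\<dots> \<le> (x - c) \<bullet> (Q *v (x - c))"
    by (rule loewner_leD[OF assms(5)])
  finally show ?thesis using assms(1) by (simp add: feasible_set_def)
qed

text \<open>Since \<open>E_diag\<close> is a supremum, the bound for each \<open>D\<close> passes to it only because some \<open>D\<close>
  is admissible; \<open>D = 0\<close> is.\<close>

lemma E_diag_le:
  fixes Q :: "real^'n^'n"
  assumes "pos_def Q" "x \<in> feasible_set Q c \<gamma>" "A \<subseteq> {n. x $ n = 0}"
  shows "E_diag Q c (card A) \<le> \<gamma>"
  unfolding E_diag_def
proof (rule cSup_least)
  have "is_diagonal (0 :: real^'n^'n)" "loewner_le 0 (0 :: real^'n^'n)"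
    by (auto simp: is_diagonal_def loewner_le_def pos_semidef_def transpose_def vec_eq_iff)
  moreover have "x \<bullet> (Q *v x) \<ge> 0" for x
    using assms(1) by (cases "x = 0") (auto simp: pos_def_def less_imp_le)
  then have "loewner_le 0 Q"
    using assms(1) by (simp add: loewner_le_def pos_semidef_def pos_def_def)
  ultimately show "{smallest_sum (card A) (\<lambda>n. D $ n $ n * (c $ n)\<^sup>2) | D.
      is_diagonal D \<and> loewner_le 0 D \<and> loewner_le D Q} \<noteq> {}"
    by blast
next
  fix s
  assume "s \<in> {smallest_sum (card A) (\<lambda>n. D $ n $ n * (c $ n)\<^sup>2) | D.
      is_diagonal D \<and> loewner_le 0 D \<and> loewner_le D Q}"
  then show "s \<le> \<gamma>" using feasible_diagonal_bound[OF assms(2,3)] by blast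
qed

lemma dd_scaled_sum_le_E_diag:
  fixes Q :: "real^'n^'n"
  assumes "pos_def Q" "dd_max Q UNIV < 1" "K \<le> CARD('n)"
  shows "(1 - dd_max Q UNIV) * smallest_sum K (\<lambda>n. Q $ n $ n * (c $ n)\<^sup>2) \<le> E_diag Q c K"
proof -
  let ?S = "{smallest_sum K (\<lambda>n. D $ n $ n * (c $ n)\<^sup>2) | D.
     is_diagonal D \<and> loewner_le 0 D \<and> loewner_le D Q}"
  obtain A :: "'n set" where A: "card A = K"
    using obtain_subset_with_card_n[OF assms(3)] by blast
  \<comment> \<open>The point \<open>0\<close> is feasible for the level \<open>c \<bullet> (Q *v c)\<close>, which thus bounds all the values.\<close>
  have "0 \<in> feasible_set Q c (c \<bullet> (Q *v c))"
    by (simp add: feasible_set_def vec.neg)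
  from feasible_diagonal_bound[OF this, of A] A
  have "s \<le> c \<bullet> (Q *v c)" if "s \<in> ?S" for s
    using that by auto
  then have "bdd_above ?S" by (meson bdd_aboveI)
  moreover have "smallest_sum K (\<lambda>n. dd_diagonal Q $ n $ n * (c $ n)\<^sup>2) \<in> ?S"
    using dd_diagonal_admissible[OF assms(1,2)] by blast
  ultimately have "smallest_sum K (\<lambda>n. dd_diagonal Q $ n $ n * (c $ n)\<^sup>2) \<le> E_diag Q c K"
    unfolding E_diag_def by (rule cSup_upper[rotated])
  then show ?thesis
    using assms(2) by (simp add: dd_diagonal_def smallest_sum_scale mult.assoc)
qed

section \<open>The chain of inequalities\<close>

lemma finite_zero_counts: "finite ((\<lambda>x :: real^'n. card {n. x $ n = 0}) ` F)"
  by (rule finite_subset[of _ "{..CARD('n)}"]) (auto intro: card_mono)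

lemma card_zeros_le_K_star:
  fixes Q :: "real^'n^'n"
  assumes "\<gamma> \<ge> 0" "x \<in> feasible_set Q c \<gamma>"
  shows "card {n. x $ n = 0} \<le> K_star Q c \<gamma>"
  unfolding K_star_eq_Max_zeros[OF assms(1)] using assms(2)
  by (intro Max_ge finite_zero_counts) auto

lemma K_star_attained:
  fixes Q :: "real^'n^'n"
  assumes "\<gamma> \<ge> 0"
  obtains x where "x \<in> feasible_set Q c \<gamma>" "card {n. x $ n = 0} = K_star Q c \<gamma>"
proof -
  have "c \<in> feasible_set Q c \<gamma>" using assms by (simp add: feasible_set_def)
  then have "K_star Q c \<gamma> \<in> (\<lambda>x. card {n. x $ n = 0}) ` feasible_set Q c \<gamma>"
    unfolding K_star_eq_Max_zeros[OF assms]
    by (intro Max_in finite_zero_counts) auto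
  then show ?thesis using that by auto
qed

text \<open>Zero denominators are covered: if \<open>b = 0\<close> then \<open>b' = 0\<close>, and \<open>a / 0\<close> is \<open>0\<close> for
  \<open>a = 0\<close> and \<open>\<infinity>\<close> for \<open>a > 0\<close>, hence still monotone in \<open>a\<close>.\<close>

lemma ratio_mono:
  assumes "0 \<le> a" "a \<le> a'" "0 \<le> b'" "b' \<le> b"
  shows "ratio a b \<le> ratio a' b'"
  using assms unfolding ratio_def divide_ereal_def
  by (intro ereal_mult_mono ereal_inverse_antimono inverse_ereal_ge0I) auto

lemma le_Max_nat:
  fixes k N :: nat
  assumes "k \<le> N" "P k"
  shows "k \<le> Max {k. k \<le> N \<and> P k}"
  using assms by (intro Max_ge) auto

lemma Max_nat_in:
  fixes k N :: nat
  assumes "k \<le> N" "P k"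
  shows "Max {k. k \<le> N \<and> P k} \<le> N" "P (Max {k. k \<le> N \<and> P k})"
proof -
  have "Max {k. k \<le> N \<and> P k} \<in> {k. k \<le> N \<and> P k}"
    using assms by (intro Max_in) auto
  then show "Max {k. k \<le> N \<and> P k} \<le> N" "P (Max {k. k \<le> N \<and> P k})" by auto
qed

text \<open>The witness zeroes the components of \<open>c\<close> in \<open>Z K\<close>, so that \<open>x - c\<close> is supported on \<open>Z K\<close> and
  the estimate may use \<open>dd_max\<close> of \<open>Z K\<close> rather than of the whole index set.\<close>

lemma K_dd_lower_le_K_star:
  fixes Q :: "real^'n^'n" and Z :: "nat \<Rightarrow> 'n set"
  assumes "pos_def Q" "\<gamma> \<ge> 0"
    and "\<And>K. smallest_index_set (\<lambda>n. Q $ n $ n * (c $ n)\<^sup>2) K (Z K)"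
  shows "K_dd_lower Q c \<gamma> Z \<le> K_star Q c \<gamma>"
proof -
  define K where "K = K_dd_lower Q c \<gamma> Z"
  define x where "x = (\<chi> n. if n \<in> Z K then 0 else c $ n)"
  let ?P = "\<lambda>K. (1 + dd_max Q (Z K)) * smallest_sum K (\<lambda>n. Q $ n $ n * (c $ n)\<^sup>2) \<le> \<gamma>"
  \<comment> \<open>\<open>dd_max Q (Z 0)\<close> is unspecified, but it is multiplied by the empty sum.\<close>
  have "?P 0" using assms(2) by simp
  then have K: "K \<le> CARD('n)" "?P K"
    unfolding K_def K_dd_lower_def using Max_nat_in[of 0 "CARD('n)" ?P] by auto
  have S: "smallest_sum K (\<lambda>n. Q $ n $ n * (c $ n)\<^sup>2) = (\<Sum>n\<in>Z K. Q $ n $ n * ((x - c) $ n)\<^sup>2)"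
    unfolding smallest_sum_eq_sum[OF assms(3)] by (intro sum.cong) (auto simp: x_def)
  have "(x - c) \<bullet> (Q *v (x - c)) \<le> (1 + dd_max Q (Z K)) * (\<Sum>n\<in>Z K. Q $ n $ n * ((x - c) $ n)\<^sup>2)"
    using quadratic_form_diagonal_estimate[OF assms(1), of "Z K" "x - c"]
    by (simp add: x_def algebra_simps abs_le_iff)
  then have "x \<in> feasible_set Q c \<gamma>"
    using K(2) by (simp add: feasible_set_def S)
  then have "card {n. x $ n = 0} \<le> K_star Q c \<gamma>"
    by (rule card_zeros_le_K_star[OF assms(2)])
  moreover have "card (Z K) \<le> card {n. x $ n = 0}"
    by (intro card_mono) (auto simp: x_def)
  moreover have "card (Z K) = K"
    using assms(3)[of K] K(1) by (simp add: smallest_index_set_def)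
  ultimately show ?thesis by (simp add: K_def)
qed

lemma K_star_le_K_diag:
  fixes Q :: "real^'n^'n"
  assumes "pos_def Q" "\<gamma> \<ge> 0"
  shows "K_star Q c \<gamma> \<le> K_diag Q c \<gamma>"
proof -
  obtain x where x: "x \<in> feasible_set Q c \<gamma>" "card {n. x $ n = 0} = K_star Q c \<gamma>"
    using K_star_attained[OF assms(2)] by blast
  then have "E_diag Q c (K_star Q c \<gamma>) \<le> \<gamma>"
    using E_diag_le[OF assms(1) x(1) order_refl] by simp
  moreover have "K_star Q c \<gamma> \<le> CARD('n)" by (simp add: K_star_def)
  ultimately show ?thesis
    unfolding K_diag_def by (intro le_Max_nat)
qed

lemma K_diag_le_K_dd_upper:
  fixes Q :: "real^'n^'n"
  assumes "pos_def Q" "dd_max Q UNIV < 1" "\<gamma> \<ge> 0"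
  shows "K_diag Q c \<gamma> \<le> K_dd_upper Q c \<gamma>"
proof -
  have "E_diag Q c 0 \<le> \<gamma>"
    using E_diag_le[OF assms(1), of c c \<gamma> "{}"] assms(3) by (simp add: feasible_set_def)
  then have K: "K_diag Q c \<gamma> \<le> CARD('n)" "E_diag Q c (K_diag Q c \<gamma>) \<le> \<gamma>"
    unfolding K_diag_def using Max_nat_in[of 0 "CARD('n)" "\<lambda>K. E_diag Q c K \<le> \<gamma>"] by auto
  then show ?thesis
    unfolding K_dd_upper_def
    using dd_scaled_sum_le_E_diag[OF assms(1,2) K(1), of c] by (intro le_Max_nat) auto
qed

text \<open>If \<open>u < l\<close>, the claim only needs \<open>r_dd \<ge> 1\<close>; this includes \<open>K_dd_lower = CARD('n)\<close>, where
  \<open>l\<close> exceeds the number of indices. Otherwise \<open>l \<le> CARD('n)\<close>, so the defining inequality of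
  \<open>K_dd_lower\<close> must fail at \<open>l\<close>, and the means of the \<open>l\<close> and the \<open>u\<close> smallest values are
  compared. Both cases clear the denominator \<open>q\<close> of \<open>r_dd\<close>.\<close>

lemma K_dd_upper_less:
  fixes Q :: "real^'n^'n" and Z :: "nat \<Rightarrow> 'n set"
  assumes "pos_def Q" "dd_max Q UNIV < 1" "\<gamma> \<ge> 0"
    and Z: "smallest_index_set (\<lambda>n. Q $ n $ n * (c $ n)\<^sup>2) (K_dd_lower Q c \<gamma> Z + 1)
              (Z (K_dd_lower Q c \<gamma> Z + 1))"
  shows "K_dd_upper Q c \<gamma> < (K_dd_lower Q c \<gamma> Z + 1) * r_dd Q c \<gamma> Z"
proof -
  define S where "S = (\<lambda>K. smallest_sum K (\<lambda>n. Q $ n $ n * (c $ n)\<^sup>2))"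
  define l where "l = K_dd_lower Q c \<gamma> Z + 1"
  define u where "u = K_dd_upper Q c \<gamma>"
  define p where "p = 1 + dd_max Q (Z l)"
  define q where "q = 1 - dd_max Q UNIV"
  have "card (Z l) \<noteq> 0"
    using Z by (simp add: smallest_index_set_def l_def)
  then have "Z l \<noteq> {}" by auto
  then have p: "p \<ge> 1" using dd_max_nonneg[OF assms(1)] by (simp add: p_def)
  have q: "0 < q" "q \<le> 1"
    using dd_max_nonneg[OF assms(1), of UNIV] assms(2) by (simp_all add: q_def)
  have "real u * q < real l * p"
  proof (cases "u < l")
    case True
    have "real u * q \<le> real u * 1" using q by (intro mult_left_mono) auto
    also have "\<dots> < real l * 1" using True by simp
    also have "\<dots> \<le> real l * p" using p by (intro mult_left_mono) auto
    finally show ?thesis .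
  next
    case False
    have u: "u \<le> CARD('n)" "q * S u \<le> \<gamma>"
      unfolding u_def K_dd_upper_def q_def S_def
      using Max_nat_in[of 0 "CARD('n)" "\<lambda>K. (1 - dd_max Q UNIV) *
        smallest_sum K (\<lambda>n. Q $ n $ n * (c $ n)\<^sup>2) \<le> \<gamma>"] assms(3) by auto
    have l_fails: "p * S l > \<gamma>"
    proof (rule ccontr)
      assume "\<not> p * S l > \<gamma>"
      then have "l \<le> K_dd_lower Q c \<gamma> Z"
        unfolding K_dd_lower_def using False u(1)
        by (intro le_Max_nat) (auto simp: p_def S_def)
      then show False by (simp add: l_def)
    qed
    \<comment> \<open>Positivity of \<open>S l\<close> is what allows its cancellation at the end.\<close>
    then have "p * S l > 0" using assms(3) by linarith
    then have S_pos: "S l > 0" using p by (simp add: zero_less_mult_iff)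
    have "real u * q * S l \<le> q * (real l * S u)"
      using smallest_sum_average_mono[of l u "\<lambda>n. Q $ n $ n * (c $ n)\<^sup>2"] False u(1) q(1)
      by (simp add: S_def)
    also have "\<dots> = real l * (q * S u)" by simp
    also have "\<dots> \<le> real l * \<gamma>" using u(2) by (intro mult_left_mono) auto
    also have "\<dots> < real l * (p * S l)" using l_fails by (simp add: l_def)
    finally have "(real u * q) * S l < (real l * p) * S l" by (simp add: mult.assoc)
    then show ?thesis using S_pos by simp
  qed
  then have "real u < real l * p / q" using q(1) by (simp add: pos_less_divide_eq)
  then show ?thesis by (simp add: u_def l_def p_def q_def r_dd_def)
qed

theorem theorem4p5:
  fixes Q :: "real^'n^'n" and c :: "real^'n" and \<gamma> :: real and Z :: "nat \<Rightarrow> 'n set"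
  assumes "pos_def Q"
    and "\<gamma> > 0"
    and "\<And>n. (c $ n)\<^sup>2 / matrix_inv Q $ n $ n \<le> \<gamma>"
    and "dd_max Q UNIV < 1"
    and "\<And>K. smallest_index_set (\<lambda>n. Q $ n $ n * (c $ n)\<^sup>2) K (Z K)"
  shows "K_dd_lower Q c \<gamma> Z \<le> K_star Q c \<gamma>
    \<and> K_star Q c \<gamma> \<le> K_diag Q c \<gamma>
    \<and> K_diag Q c \<gamma> \<le> K_dd_upper Q c \<gamma>
    \<and> ratio (K_diag Q c \<gamma>) (K_star Q c \<gamma>) \<le> ratio (K_dd_upper Q c \<gamma>) (K_dd_lower Q c \<gamma> Z)
    \<and> ratio (K_dd_upper Q c \<gamma>) (K_dd_lower Q c \<gamma> Z)
        \<le> ratio (\<lceil>(K_dd_lower Q c \<gamma> Z + 1) * r_dd Q c \<gamma> Z\<rceil> - 1) (K_dd_lower Q c \<gamma> Z)"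
proof -
  have \<gamma>: "\<gamma> \<ge> 0" using assms(2) by simp
  have lower: "K_dd_lower Q c \<gamma> Z \<le> K_star Q c \<gamma>"
    by (rule K_dd_lower_le_K_star[OF assms(1) \<gamma> assms(5)])
  have mid: "K_star Q c \<gamma> \<le> K_diag Q c \<gamma>"
    by (rule K_star_le_K_diag[OF assms(1) \<gamma>])
  have upper: "K_diag Q c \<gamma> \<le> K_dd_upper Q c \<gamma>"
    by (rule K_diag_le_K_dd_upper[OF assms(1,4) \<gamma>])
  have "real (K_dd_upper Q c \<gamma>) < (K_dd_lower Q c \<gamma> Z + 1) * r_dd Q c \<gamma> Z"
    using K_dd_upper_less[OF assms(1,4) \<gamma> assms(5)] by simp
  then have "int (K_dd_upper Q c \<gamma>) < \<lceil>(K_dd_lower Q c \<gamma> Z + 1) * r_dd Q c \<gamma> Z\<rceil>"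
    by (simp add: less_ceiling_iff)
  then have "int (K_dd_upper Q c \<gamma>) \<le> \<lceil>(K_dd_lower Q c \<gamma> Z + 1) * r_dd Q c \<gamma> Z\<rceil> - 1"
    by linarith
  then have "real_of_int (int (K_dd_upper Q c \<gamma>))
      \<le> real_of_int (\<lceil>(K_dd_lower Q c \<gamma> Z + 1) * r_dd Q c \<gamma> Z\<rceil> - 1)"
    by (simp only: of_int_le_iff)
  then have "real (K_dd_upper Q c \<gamma>)
      \<le> real_of_int (\<lceil>(K_dd_lower Q c \<gamma> Z + 1) * r_dd Q c \<gamma> Z\<rceil> - 1)"
    by simp
  then show ?thesis
    using lower mid upper by (intro conjI ratio_mono) auto
qed

end
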